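(* Let $\alpha\in(0,1)$, $t_0\in\mathbb{R}$ and $\lambda\in\mathbb{R}\setminus\{2\}$. (a) There exists a polynomial function $P_\lambda$ with real coefficients satisfying $$D_{t_0,t}^\alpha\big[P_\lambda(t)\big]^2>\lambda\Big[D_{t_0,t}^\alpha P_\lambda(t)\Big]P_\lambda(t),\quad\text{for some }t>t_0.$$ (b) There exists a polynomial function $Q_\lambda$ with real coefficients satisfying $$cD_{t_0,t}^\alpha\big[Q_\lambda(t)\big]^2>\lambda\Big[cD_{t_0,t}^\alpha Q_\lambda(t)\Big]Q_\lambda(t),\quad\text{for some }t>t_0.$$
   Context: For $\alpha\in(0,1)$, the Riemann-Liouville fractional derivative of order $\alpha$ at $t_0$ is $$D_{t_0,t}^\alpha f(t)=\frac{d}{dt}\left\{\frac{1}{\Gamma(1-\alpha)}\int_{t_0}^t (t-s)^{-\alpha}f(s)\,ds\right\},$$ and the Caputo fractional derivative of order $\alpha$ at $t_0$ is $cD_{t_0,t}^\alpha f(t)=D_{t_0,t}^\alpha\big[f(t)-f(t_0)\big]$. The notation $D_{t_0,t}^\alpha[P(t)]^2$ means the fractional derivative of the function $t\mapsto P(t)^2$ (and similarly for $cD$). For polynomials these derivatives exist at every $t>t_0$: for $k\in\mathbb{N}$, $D_{t_0,t}^\alpha (t-t_0)^k=\frac{\Gamma(k+1)}{\Gamma(k+1-\alpha)}(t-t_0)^{k-\alpha}$, and $cD_{t_0,t}^\alpha(t-t_0)^k$ is the same for $k>0$ and equals $0$ for $k=0$. *)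

theory Defs
  imports
    "HOL-Analysis.Analysis"
    "HOL-Computational_Algebra.Polynomial"
begin

text \<open>
  For \<open>0 < \<alpha> < 1\<close> the kernel \<open>(t - s) powr (- \<alpha>)\<close> is singular at \<open>s = t\<close>, where \<open>powr\<close> takes
  the value \<open>0\<close>; this single point does not affect the integral. The derivative is meaningful only
  where it exists, which for polynomial \<open>f\<close> is the case at every \<open>t > t0\<close>.
\<close>

definition rl_fractional_deriv :: "real \<Rightarrow> real \<Rightarrow> (real \<Rightarrow> real) \<Rightarrow> real \<Rightarrow> real" where
  "rl_fractional_deriv \<alpha> t0 f t =
     deriv (\<lambda>u. 1 / Gamma (1 - \<alpha>) * integral {t0..u} (\<lambda>s. (u - s) powr (- \<alpha>) * f s)) t"

definition caputo_fractional_deriv :: "real \<Rightarrow> real \<Rightarrow> (real \<Rightarrow> real) \<Rightarrow> real \<Rightarrow> real" where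
  "caputo_fractional_deriv \<alpha> t0 f t = rl_fractional_deriv \<alpha> t0 (\<lambda>s. f s - f t0) t"

end

theory Submission
  imports Defs "HOL-Real_Asymp.Real_Asymp"
begin

text \<open>
  Write \<open>\<lambda>\<close> for \<open>lam\<close>, take \<open>c = \<lambda> / 2 - 1 \<noteq> 0\<close> and \<open>P(s) = 1 + c - c (s - t0)^k\<close>, so that
  \<open>P(t0 + 1) = 1\<close>. Let \<open>g n\<close> be the derivative of \<open>(s - t0)^n\<close> at \<open>t = t0 + 1\<close>. In
  \<open>D P\<^sup>2 - \<lambda> P D P\<close> the terms in \<open>g k\<close> cancel at \<open>t0 + 1\<close>, because \<open>\<lambda> = 2 (1 + c)\<close>, and what
  remains is \<open>c\<^sup>2 g (2 k) - (1 + c)\<^sup>2 g 0\<close>. In the Riemann-Liouville case this is positive for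
  large \<open>k\<close>, since \<open>g n\<close> grows like \<open>n powr \<alpha>\<close>; in the Caputo case \<open>g 0\<close> is replaced by \<open>0\<close>
  and already \<open>k = 1\<close> works.
\<close>

text \<open>The substitution \<open>t = (s - a) / (u - a)\<close> turns this into the Beta integral
  over the unit interval.\<close>

lemma has_integral_kernel_power:
  fixes \<alpha> a u :: real
  assumes "\<alpha> < 1" and "a < u"
  shows "((\<lambda>s. (u - s) powr (- \<alpha>) * (s - a) ^ k) has_integral
           Beta (real k + 1) (1 - \<alpha>) * (u - a) powr (real k + 1 - \<alpha>)) {a..u}"
proof -
  define h where "h = u - a"
  have h: "h > 0" and "u = a + h" using assms by (simp_all add: h_def)
  have beta: "((\<lambda>t. t powr real k * (1 - t) powr (- \<alpha>)) has_integral Beta (real k + 1) (1 - \<alpha>)) (cbox 0 1)"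
    using has_integral_Beta_real[of "real k + 1" "1 - \<alpha>"] assms by simp
  have ends: "(0 - - a / h) /\<^sub>R (1 / h) = a" "(1 - - a / h) /\<^sub>R (1 / h) = u"
    using h by (simp_all add: divide_inverse algebra_simps) (simp add: h_def)
  from has_integral_affinity'[OF beta, of "1 / h" "- a / h", unfolded ends] h
  have "((\<lambda>s. (s / h - a / h) powr real k * (1 - (s / h - a / h)) powr (- \<alpha>)) has_integral
          Beta (real k + 1) (1 - \<alpha>) * h) {a..u}"
    by (simp add: mult.commute)
  \<comment> \<open>The factor \<open>h powr (real k - \<alpha>)\<close> undoes the scaling by
    \<open>1 / h\<close> in both powers. The endpoints are dropped because for \<open>k = 0\<close>
    the integrands differ at \<open>s = a\<close>: \<open>0 powr 0\<close> is 0, while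
    \<open>0 ^ 0\<close> is 1.\<close>
  from has_integral_mult_right[OF this, of "h powr (real k - \<alpha>)"]
  have "((\<lambda>s. h powr (real k - \<alpha>) * ((s / h - a / h) powr real k * (1 - (s / h - a / h)) powr (- \<alpha>)))
          has_integral Beta (real k + 1) (1 - \<alpha>) * h powr (real k + 1 - \<alpha>)) {a<..<u}"
    using h by (simp add: has_integral_Icc_iff_Ioo mult_ac powr_add powr_diff)
  moreover have "h powr (real k - \<alpha>) * ((s / h - a / h) powr real k * (1 - (s / h - a / h)) powr (- \<alpha>))
      = (u - s) powr (- \<alpha>) * (s - a) ^ k" if "s \<in> {a<..<u}" for s
  proof -
    have eqs: "s / h - a / h = (s - a) / h" "1 - (s - a) / h = (u - s) / h"
      using h \<open>u = a + h\<close> by (simp_all add: field_simps)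
    show ?thesis
      unfolding eqs using h that
      by (simp add: powr_divide powr_diff powr_minus powr_realpow field_simps)
  qed
  ultimately show ?thesis
    unfolding has_integral_Icc_iff_Ioo h_def by (rule has_integral_eq[rotated]) auto
qed

text \<open>Dividing \<open>Beta (n + 1) (1 - \<alpha>)\<close> by
  \<open>Gamma (1 - \<alpha>)\<close> leaves \<open>B n\<close>. Differentiating brings down the
  factor \<open>n + 1 - \<alpha>\<close>, which lowers the Gamma argument in \<open>B n\<close> by
  one. The exponents \<open>e i\<close> may repeat.\<close>

lemma rl_fractional_deriv_sum_powers:
  fixes \<alpha> t0 t :: real and e :: "'i \<Rightarrow> nat"
  assumes "\<alpha> < 1" and "t0 < t" and "finite I"
  shows "rl_fractional_deriv \<alpha> t0 (\<lambda>s. \<Sum>i\<in>I. c i * (s - t0) ^ e i) t =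
           (\<Sum>i\<in>I. c i * (fact (e i) / Gamma (real (e i) + 1 - \<alpha>)) * (t - t0) powr (real (e i) - \<alpha>))"
proof -
  define B where "B n = fact n / Gamma (real n + 2 - \<alpha>)" for n
  have Gamma_pos: "Gamma (1 - \<alpha>) > 0" using assms by simp
  have Gamma_step: "Gamma (real n + 2 - \<alpha>) = (real n + 1 - \<alpha>) * Gamma (real n + 1 - \<alpha>)" for n
    using Gamma_plus1[of "real n + 1 - \<alpha>"] assms by (simp add: algebra_simps nonpos_Ints_def)
  have B: "Beta (real n + 1) (1 - \<alpha>) = Gamma (1 - \<alpha>) * B n" for n
    using Gamma_fact[of n, where 'a = real] by (simp add: Beta_def B_def algebra_simps)
  have int: "1 / Gamma (1 - \<alpha>) *
       integral {t0..u} (\<lambda>s. (u - s) powr (- \<alpha>) * (\<Sum>i\<in>I. c i * (s - t0) ^ e i)) =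
       (\<Sum>i\<in>I. c i * B (e i) * (u - t0) powr (real (e i) + 1 - \<alpha>))" if "t0 < u" for u
  proof -
    have "((\<lambda>s. \<Sum>i\<in>I. c i * ((u - s) powr (- \<alpha>) * (s - t0) ^ e i)) has_integral
      (\<Sum>i\<in>I. c i * (Beta (real (e i) + 1) (1 - \<alpha>) * (u - t0) powr (real (e i) + 1 - \<alpha>)))) {t0..u}"
      using assms that
      by (intro has_integral_sum has_integral_mult_right has_integral_kernel_power) auto
    then have "integral {t0..u} (\<lambda>s. (u - s) powr (- \<alpha>) * (\<Sum>i\<in>I. c i * (s - t0) ^ e i)) =
      Gamma (1 - \<alpha>) * (\<Sum>i\<in>I. c i * B (e i) * (u - t0) powr (real (e i) + 1 - \<alpha>))"
      by (intro integral_unique) (simp add: sum_distrib_left B mult_ac)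
    then show ?thesis using Gamma_pos by simp
  qed
  have "((\<lambda>u. \<Sum>i\<in>I. c i * B (e i) * (u - t0) powr (real (e i) + 1 - \<alpha>)) has_real_derivative
      (\<Sum>i\<in>I. c i * (fact (e i) / Gamma (real (e i) + 1 - \<alpha>)) * (t - t0) powr (real (e i) - \<alpha>))) (at t)"
  proof (rule DERIV_sum)
    fix i
    have "real (e i) + 1 - \<alpha> > 0" using assms by simp
    then have "(real (e i) + 1 - \<alpha>) * B (e i) = fact (e i) / Gamma (real (e i) + 1 - \<alpha>)"
      by (simp add: B_def Gamma_step)
    moreover have "((\<lambda>u. c i * B (e i) * (u - t0) powr (real (e i) + 1 - \<alpha>)) has_real_derivative
        c i * ((real (e i) + 1 - \<alpha>) * B (e i)) * (t - t0) powr (real (e i) - \<alpha>)) (at t)"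
      using assms by (auto intro!: derivative_eq_intros simp: algebra_simps)
    ultimately show "((\<lambda>u. c i * B (e i) * (u - t0) powr (real (e i) + 1 - \<alpha>)) has_real_derivative
        c i * (fact (e i) / Gamma (real (e i) + 1 - \<alpha>)) * (t - t0) powr (real (e i) - \<alpha>)) (at t)"
      by simp
  qed
  \<comment> \<open>The closed form \<open>int\<close> holds on the open half-line
    \<open>u > t0\<close>, a neighbourhood of \<open>t\<close>, which suffices for the derivative
    there.\<close>
  then have "((\<lambda>u. 1 / Gamma (1 - \<alpha>) *
       integral {t0..u} (\<lambda>s. (u - s) powr (- \<alpha>) * (\<Sum>i\<in>I. c i * (s - t0) ^ e i))) has_real_derivative
      (\<Sum>i\<in>I. c i * (fact (e i) / Gamma (real (e i) + 1 - \<alpha>)) * (t - t0) powr (real (e i) - \<alpha>))) (at t)"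
    by (rule has_field_derivative_transform_within_open[of _ _ _ "{t0<..}"])
       (use assms int in auto)
  then show ?thesis unfolding rl_fractional_deriv_def by (rule DERIV_imp_deriv)
qed

text \<open>At distance 1 from \<open>t0\<close> all powers of \<open>t - t0\<close> equal 1, so
  only the Gamma quotients survive.\<close>

lemma rl_fractional_deriv_trinomial:
  fixes \<alpha> t0 :: real
  assumes "\<alpha> < 1"
  shows "rl_fractional_deriv \<alpha> t0 (\<lambda>s. a + b * (s - t0) ^ m + d * (s - t0) ^ n) (t0 + 1) =
           a / Gamma (1 - \<alpha>) + b * (fact m / Gamma (real m + 1 - \<alpha>))
             + d * (fact n / Gamma (real n + 1 - \<alpha>))"
  using rl_fractional_deriv_sum_powers[of \<alpha> t0 "t0 + 1" "{0, 1, 2 :: nat}"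
      "\<lambda>i. if i = 0 then a else if i = 1 then b else d"
      "\<lambda>i. if i = 0 then 0 else if i = 1 then m else n"] assms
  by (simp add: add.assoc)

text \<open>\<open>Gamma_series (1 - \<alpha>) n\<close> converges to
  \<open>Gamma (1 - \<alpha>) > 0\<close>. The quotient is this series times an explicit factor of
  order \<open>n powr \<alpha>\<close>.\<close>

lemma filterlim_fact_over_Gamma:
  fixes \<alpha> :: real
  assumes "0 < \<alpha>" and "\<alpha> < 1"
  shows "filterlim (\<lambda>n. fact n / Gamma (real n + 1 - \<alpha>)) at_top sequentially"
proof -
  define G where "G = Gamma (1 - \<alpha>)"
  have G: "G > 0" using assms by (simp add: G_def)
  have "filterlim (\<lambda>n. (real n + 1 - \<alpha>) / (real n powr (1 - \<alpha>) * G)) at_top sequentially"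
    using assms G by real_asymp
  then have lim: "filterlim (\<lambda>n. Gamma_series (1 - \<alpha>) n * ((real n + 1 - \<alpha>) / (real n powr (1 - \<alpha>) * G)))
      at_top sequentially"
    using G unfolding G_def
    by (intro filterlim_tendsto_pos_mult_at_top[OF Gamma_series_LIMSEQ])
  show ?thesis
  \<comment> \<open>The identity fails at \<open>n = 0\<close>, where
    \<open>real n powr (1 - \<alpha>)\<close> is 0 and division by it yields 0.\<close>
  proof (rule filterlim_cong[THEN iffD1, OF refl refl _ lim], rule eventually_mono[OF eventually_gt_at_top[of 0]])
    fix n :: nat assume n: "0 < n"
    have "1 - \<alpha> \<notin> \<int>\<^sub>\<le>\<^sub>0"
      using assms by (auto elim!: nonpos_Ints_cases)
    then have "pochhammer (1 - \<alpha>) (n + 1) = (real n + 1 - \<alpha>) * Gamma (real n + 1 - \<alpha>) / G"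
      using pochhammer_Gamma[of "1 - \<alpha>" "n + 1"] Gamma_plus1[of "real n + 1 - \<alpha>"] assms
      by (simp add: G_def algebra_simps nonpos_Ints_def)
    moreover have "exp ((1 - \<alpha>) * ln (real n)) = real n powr (1 - \<alpha>)"
      using n by (simp add: powr_def)
    moreover have "real n + 1 - \<alpha> > 0" "Gamma (real n + 1 - \<alpha>) > 0" using assms by auto
    ultimately show "Gamma_series (1 - \<alpha>) n * ((real n + 1 - \<alpha>) / (real n powr (1 - \<alpha>) * G)) =
        fact n / Gamma (real n + 1 - \<alpha>)"
      using n G by (simp add: Gamma_series_def)
  qed
qed

theorem theorem31:
  fixes \<alpha> t0 lam :: real
  assumes "0 < \<alpha>" and "\<alpha> < 1" and "lam \<noteq> 2"
  shows "(\<exists>P :: real poly. \<exists>t > t0.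
            rl_fractional_deriv \<alpha> t0 (\<lambda>s. (poly P s)\<^sup>2) t
              > lam * rl_fractional_deriv \<alpha> t0 (poly P) t * poly P t)
       \<and> (\<exists>Q :: real poly. \<exists>t > t0.
            caputo_fractional_deriv \<alpha> t0 (\<lambda>s. (poly Q s)\<^sup>2) t
              > lam * caputo_fractional_deriv \<alpha> t0 (poly Q) t * poly Q t)"
proof -
  define c where "c = lam / 2 - 1"
  have c: "c \<noteq> 0" and lam: "lam = 2 * (1 + c)" using assms(3) by (auto simp: c_def)
  define g :: "nat \<Rightarrow> real" where "g n = fact n / Gamma (real n + 1 - \<alpha>)" for n
  define P where "P k = [:1 + c:] - smult c ([:- t0, 1:] ^ k)" for k
  have poly_P: "poly (P k) s = 1 + c - c * (s - t0) ^ k" for k s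
    by (simp add: P_def)
  have D: "rl_fractional_deriv \<alpha> t0 (\<lambda>s. a + b * (s - t0) ^ m + d * (s - t0) ^ n) (t0 + 1) =
      a * g 0 + b * g m + d * g n" for a b d m n
    using rl_fractional_deriv_trinomial[OF assms(2)] by (simp add: g_def)
  have square: "(1 + c - c * x ^ k)\<^sup>2 = (1 + c)\<^sup>2 + (- 2 * c * (1 + c)) * x ^ k + c\<^sup>2 * x ^ (2 * k)" for x k
    unfolding power_even_eq power2_eq_square by (simp add: algebra_simps)
  \<comment> \<open>The third term of the trinomial is switched off by \<open>d = 0\<close>; its
    exponent is then arbitrary.\<close>
  have rl_P: "rl_fractional_deriv \<alpha> t0 (poly (P k)) (t0 + 1) = (1 + c) * g 0 - c * g k" for k
    using D[of "1 + c" "- c" k 0 0] by (simp add: poly_P[abs_def])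
  have rl_P2: "rl_fractional_deriv \<alpha> t0 (\<lambda>s. (poly (P k) s)\<^sup>2) (t0 + 1) =
      (1 + c)\<^sup>2 * g 0 + (- 2 * c * (1 + c)) * g k + c\<^sup>2 * g (2 * k)" for k
    unfolding poly_P square by (rule D)
  have "filterlim (\<lambda>k. g (2 * k)) at_top sequentially"
    unfolding g_def
    by (rule filterlim_compose[OF filterlim_fact_over_Gamma[OF assms(1,2)]]) real_asymp
  then obtain k where "g (2 * k) > (1 + c)\<^sup>2 * g 0 / c\<^sup>2"
    by (metis (mono_tags, lifting) eventually_sequentially filterlim_at_top_dense order_refl)
  then have "c\<^sup>2 * g (2 * k) > (1 + c)\<^sup>2 * g 0"
    using c by (simp add: field_simps)
  then have rl: "rl_fractional_deriv \<alpha> t0 (\<lambda>s. (poly (P k) s)\<^sup>2) (t0 + 1)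
      > lam * rl_fractional_deriv \<alpha> t0 (poly (P k)) (t0 + 1) * poly (P k) (t0 + 1)"
    unfolding rl_P rl_P2 by (simp add: poly_P lam power2_eq_square algebra_simps)
  \<comment> \<open>Since \<open>P 1\<close> takes the value \<open>1 + c\<close> at
    \<open>t0\<close>, the Caputo shift removes exactly the constant term, hence
    \<open>a = 0\<close>; likewise \<open>(1 + c)\<^sup>2\<close> for the square.\<close>
  have ca_P: "caputo_fractional_deriv \<alpha> t0 (poly (P 1)) (t0 + 1) = - c * g 1"
    using D[of 0 "- c" 1 0 0] by (simp add: caputo_fractional_deriv_def poly_P)
  have ca_P2: "caputo_fractional_deriv \<alpha> t0 (\<lambda>s. (poly (P 1) s)\<^sup>2) (t0 + 1) =
      (- 2 * c * (1 + c)) * g 1 + c\<^sup>2 * g 2"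
    using D[of 0 "- 2 * c * (1 + c)" 1 "c\<^sup>2" 2] square[of _ 1]
    by (simp add: caputo_fractional_deriv_def poly_P)
  \<comment> \<open>After the \<open>g 1\<close> terms cancel, the Caputo difference is exactly
    \<open>c\<^sup>2 * g 2\<close>.\<close>
  have "g 2 > 0" using assms by (simp add: g_def)
  then have "c\<^sup>2 * g 2 > 0" using c by simp
  then have ca: "caputo_fractional_deriv \<alpha> t0 (\<lambda>s. (poly (P 1) s)\<^sup>2) (t0 + 1)
      > lam * caputo_fractional_deriv \<alpha> t0 (poly (P 1)) (t0 + 1) * poly (P 1) (t0 + 1)"
    unfolding ca_P ca_P2 by (simp add: poly_P lam algebra_simps)
  show ?thesis
    by (intro conjI exI[of _ "P k"] exI[of _ "P 1"] exI[of _ "t0 + 1"] rl ca) simp_all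
qed

end
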